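(* Let $d\ge 4$ be even and let $U\in M_d$ be a unitary matrix which is antisymmetric, i.e. $U^T=-U$. Then the Breuer–Hall map $\varphi^d_U : M_d \to M_d$ defined by $$\varphi^d_U(X) = \mathrm{Tr}(X)\,\mathbb{I}_d - X - U X^T U^*$$ is atomic.
   Context: $M_d$ is the algebra of $d\times d$ complex matrices, $M_d^+$ its cone of positive semidefinite elements, $\mathbb{I}_d$ the identity matrix, $X^T$ the transpose and $X^*$ the conjugate transpose; $\tau(X)=X^T$ denotes the transposition map on $M_d$. The Schmidt number $\mathrm{SN}(\rho)$ of $\rho\in (M_d\otimes M_d)^+$ is the smallest $r$ such that $\rho$ is a sum of operators $|\psi\rangle\langle\psi|$ with $\psi\in\mathbb{C}^d\otimes\mathbb{C}^d$ of Schmidt rank at most $r$. Put $\mathrm{V}_k=\{\rho\in (M_d\otimes M_d)^+ : \mathrm{SN}(\rho)\le k\}$ and $\mathrm{V}^k=(\mathrm{id}\otimes\tau)\mathrm{V}_k$. A linear map $\varphi:M_d\to M_d$ is positive if $\varphi(M_d^+)\subseteq M_d^+$; it is $k$-positive if $(\mathrm{id}\otimes\varphi)(\mathrm{V}_k)\subseteq (M_d\otimes M_d)^+$, and $k$-copositive if $(\mathrm{id}\otimes\varphi)(\mathrm{V}^k)\subseteq (M_d\otimes M_d)^+$ (equivalently, $\varphi\circ\tau$ is $k$-positive). $\mathrm{P}_k$ and $\mathrm{P}^k$ denote the convex cones of $k$-positive and $k$-copositive maps. A map $\varphi$ is atomic if it is positive and $\varphi\notin \mathrm{P}_2+\mathrm{P}^2$,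 i.e. it is not the sum of a 2-positive and a 2-copositive map. *)

theory Defs
  imports "HOL-Analysis.Analysis"
begin

text \<open>
  \<^typ>\<open>complex ^ 'n ^ 'n\<close> plays the role of \<open>M\<^sub>d\<close> with \<open>d = CARD('n)\<close>.  The tensor product
  \<open>M\<^sub>d \<otimes> M\<^sub>d\<close> is the algebra of matrices indexed by pairs, the first component of an index
  belonging to the first tensor factor; likewise for \<open>\<complex>\<^sup>d \<otimes> \<complex>\<^sup>d\<close>.
\<close>

type_synonym 'n cmat = "complex ^ 'n ^ 'n"

definition cscale :: "complex \<Rightarrow> 'n::finite cmat \<Rightarrow> 'n cmat" where
  "cscale c A = (\<chi> i j. c * A $ i $ j)"

definition conj_transpose :: "'n::finite cmat \<Rightarrow> 'n cmat" where
  "conj_transpose A = (\<chi> i j. cnj (A $ j $ i))"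

definition unitary_mat :: "'n::finite cmat \<Rightarrow> bool" where
  "unitary_mat U \<longleftrightarrow> conj_transpose U ** U = mat 1 \<and> U ** conj_transpose U = mat 1"

text \<open>Once \<open>A\<close> is Hermitian the quadratic form is real, so its real part is its value.\<close>

definition psd :: "'n::finite cmat set" where
  "psd = {A. conj_transpose A = A \<and>
             (\<forall>v. 0 \<le> Re (\<Sum>i\<in>UNIV. cnj (v $ i) * (A *v v) $ i))}"

text \<open>The predicate \<open>linear\<close> of the analysis library means linear over the reals.\<close>

definition clinear_map :: "('n::finite cmat \<Rightarrow> 'm::finite cmat) \<Rightarrow> bool" where
  "clinear_map \<phi> \<longleftrightarrow> Vector_Spaces.linear cscale cscale \<phi>"

definition tensor_vec ::
    "complex ^ 'n::finite \<Rightarrow> complex ^ 'm::finite \<Rightarrow> complex ^ ('n \<times> 'm)" where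
  "tensor_vec a b = (\<chi> p. a $ fst p * b $ snd p)"

definition tensor_mat :: "'n::finite cmat \<Rightarrow> 'm::finite cmat \<Rightarrow> ('n \<times> 'm) cmat" where
  "tensor_mat A B = (\<chi> p q. A $ fst p $ fst q * B $ snd p $ snd q)"

definition ketbra :: "complex ^ 'n::finite \<Rightarrow> 'n cmat" where
  "ketbra \<psi> = (\<chi> p q. \<psi> $ p * cnj (\<psi> $ q))"

definition schmidt_rank :: "complex ^ ('n::finite \<times> 'n) \<Rightarrow> nat" where
  "schmidt_rank \<psi> = (LEAST r::nat. \<exists>a b. \<psi> = (\<Sum>i<r. tensor_vec (a i) (b i)))"

text \<open>Every positive semidefinite matrix has such a decomposition, by the spectral theorem;
  on other matrices the value of \<open>schmidt_number\<close> is irrelevant.\<close>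

definition schmidt_number :: "('n::finite \<times> 'n) cmat \<Rightarrow> nat" where
  "schmidt_number \<rho> =
     (LEAST r::nat. \<exists>(m::nat) \<psi>. \<rho> = (\<Sum>i<m. ketbra (\<psi> i)) \<and> (\<forall>i<m. schmidt_rank (\<psi> i) \<le> r))"

text \<open>\<open>block X i j\<close> is the matrix \<open>X\<^sub>i\<^sub>j\<close> in \<open>X = \<Sum>\<^sub>i\<^sub>j E\<^sub>i\<^sub>j \<otimes> X\<^sub>i\<^sub>j\<close>, and \<open>id_tensor \<phi> X\<close> is
  \<open>\<Sum>\<^sub>i\<^sub>j E\<^sub>i\<^sub>j \<otimes> \<phi> X\<^sub>i\<^sub>j\<close>.\<close>

definition block :: "('n::finite \<times> 'm::finite) cmat \<Rightarrow> 'n \<Rightarrow> 'n \<Rightarrow> 'm cmat" where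
  "block X i j = (\<chi> k l. X $ (i, k) $ (j, l))"

definition id_tensor ::
    "('m::finite cmat \<Rightarrow> 'm cmat) \<Rightarrow> ('n::finite \<times> 'm) cmat \<Rightarrow> ('n \<times> 'm) cmat" where
  "id_tensor \<phi> X = (\<chi> p q. \<phi> (block X (fst p) (fst q)) $ snd p $ snd q)"

definition V_lower :: "nat \<Rightarrow> ('n::finite \<times> 'n) cmat set" where
  "V_lower k = {\<rho> \<in> psd. schmidt_number \<rho> \<le> k}"

definition V_upper :: "nat \<Rightarrow> ('n::finite \<times> 'n) cmat set" where
  "V_upper k = id_tensor transpose ` V_lower k"

definition positive_map :: "('n::finite cmat \<Rightarrow> 'n cmat) \<Rightarrow> bool" where
  "positive_map \<phi> \<longleftrightarrow> clinear_map \<phi> \<and> \<phi> ` psd \<subseteq> psd"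

definition P_lower :: "nat \<Rightarrow> ('n::finite cmat \<Rightarrow> 'n cmat) set" where
  "P_lower k = {\<phi>. clinear_map \<phi> \<and> id_tensor \<phi> ` V_lower k \<subseteq> psd}"

definition P_upper :: "nat \<Rightarrow> ('n::finite cmat \<Rightarrow> 'n cmat) set" where
  "P_upper k = {\<phi>. clinear_map \<phi> \<and> id_tensor \<phi> ` V_upper k \<subseteq> psd}"

definition atomic :: "('n::finite cmat \<Rightarrow> 'n cmat) \<Rightarrow> bool" where
  "atomic \<phi> \<longleftrightarrow> positive_map \<phi> \<and>
     \<not> (\<exists>\<phi>\<^sub>1 \<in> P_lower 2. \<exists>\<phi>\<^sub>2 \<in> P_upper 2. \<phi> = (\<lambda>X. \<phi>\<^sub>1 X + \<phi>\<^sub>2 X))"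

definition breuer_hall :: "'n::finite cmat \<Rightarrow> 'n cmat \<Rightarrow> 'n cmat" where
  "breuer_hall U X = cscale (trace X) (mat 1) - X - U ** transpose X ** conj_transpose U"


lemma vector_space_cscale: "vector_space (cscale :: complex \<Rightarrow> 'n::finite cmat \<Rightarrow> _)"
  by unfold_locales (simp_all add: cscale_def vec_eq_iff algebra_simps)

lemma clinear_map_iff:
  "clinear_map \<phi> \<longleftrightarrow>
     (\<forall>A B. \<phi> (A + B) = \<phi> A + \<phi> B) \<and> (\<forall>c A. \<phi> (cscale c A) = cscale c (\<phi> A))"
  unfolding clinear_map_def Vector_Spaces.linear_iff
  by (simp add: vector_space_cscale)

lemma id_tensor_tensor_mat:
  assumes "clinear_map \<phi>"
  shows "id_tensor \<phi> (tensor_mat A B) = tensor_mat A (\<phi> B)"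
proof -
  have block: "block (tensor_mat A B) i j = cscale (A $ i $ j) B" for i j
    by (simp add: block_def tensor_mat_def cscale_def vec_eq_iff)
  have "\<phi> (cscale c B) = cscale c (\<phi> B)" for c
    using assms by (simp add: clinear_map_iff)
  then show ?thesis
    unfolding id_tensor_def block by (simp add: tensor_mat_def cscale_def)
qed

lemma schmidt_rank_le_iff:
  "schmidt_rank (\<psi> :: complex ^ ('n::finite \<times> 'n)) \<le> k \<longleftrightarrow>
     (\<exists>a b. \<psi> = (\<Sum>i<k. tensor_vec (a i) (b i)))"
proof
  obtain e :: "nat \<Rightarrow> 'n" where e: "bij_betw e {..<CARD('n)} UNIV"
    using ex_bij_betw_nat_finite[of "UNIV :: 'n set"] by (auto simp: lessThan_atLeast0)
  have "\<psi> = (\<Sum>i<CARD('n). tensor_vec (axis (e i) 1) (\<chi> l. \<psi> $ (e i, l)))"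
  proof -
    have "(\<Sum>i<CARD('n). tensor_vec (axis (e i) 1) (\<chi> l. \<psi> $ (e i, l)))
        = (\<Sum>i\<in>UNIV. tensor_vec (axis i 1) (\<chi> l. \<psi> $ (i, l)))"
      using sum.reindex_bij_betw[OF e, of "\<lambda>i. tensor_vec (axis i 1) (\<chi> l. \<psi> $ (i, l))"] .
    also have "\<dots> = \<psi>"
    proof (subst vec_eq_iff, intro allI)
      fix p :: "'n \<times> 'n"
      have "(\<Sum>i\<in>UNIV. tensor_vec (axis i 1) (\<chi> l. \<psi> $ (i, l))) $ p
          = (\<Sum>i\<in>UNIV. if i = fst p then \<psi> $ p else 0)"
        unfolding sum_component
        by (intro sum.cong) (cases p; auto simp: tensor_vec_def axis_def)+
      then show "(\<Sum>i\<in>UNIV. tensor_vec (axis i 1) (\<chi> l. \<psi> $ (i, l))) $ p = \<psi> $ p"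
        by (simp del: sum_component)
    qed
    finally show ?thesis by simp
  qed
  moreover define a0 :: "nat \<Rightarrow> complex ^ 'n" where "a0 i = axis (e i) 1" for i
  moreover define b0 :: "nat \<Rightarrow> complex ^ 'n" where "b0 i = (\<chi> l. \<psi> $ (e i, l))" for i
  ultimately have "\<psi> = (\<Sum>i<CARD('n). tensor_vec (a0 i) (b0 i))"
    by simp
  then have ex: "\<exists>r::nat. \<exists>a b. \<psi> = (\<Sum>i<r. tensor_vec (a i) (b i))"
    by blast
  assume le: "schmidt_rank \<psi> \<le> k"
  obtain a b where ab: "\<psi> = (\<Sum>i<schmidt_rank \<psi>. tensor_vec (a i) (b i))"
    using LeastI_ex[OF ex] unfolding schmidt_rank_def by blast
  define a' where "a' i = (if i < schmidt_rank \<psi> then a i else 0)" for i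
  have "(\<Sum>i<k. tensor_vec (a' i) (b i)) = (\<Sum>i<schmidt_rank \<psi>. tensor_vec (a' i) (b i))"
    using le by (intro sum.mono_neutral_right)
      (auto simp: a'_def tensor_vec_def vec_eq_iff)
  also have "\<dots> = (\<Sum>i<schmidt_rank \<psi>. tensor_vec (a i) (b i))"
    by (simp add: a'_def)
  finally show "\<exists>a b. \<psi> = (\<Sum>i<k. tensor_vec (a i) (b i))"
    using ab by metis
next
  assume "\<exists>a b. \<psi> = (\<Sum>i<k. tensor_vec (a i) (b i))"
  then show "schmidt_rank \<psi> \<le> k"
    unfolding schmidt_rank_def by (rule Least_le)
qed

end

theory Submission
  imports Defs
begin

text \<open>
  Put \<open>y = conj (U\<^sup>* v)\<close>.  Antisymmetry and unitarity of \<open>U\<close> make \<open>v\<close> and \<open>y\<close> orthogonal vectors of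
  equal length, and the quadratic form of \<open>\<phi> X\<close> at \<open>v\<close> is \<open>Tr (X P)\<close> with
  \<open>P = |v|\<^sup>2 I - v v\<^sup>* - y y\<^sup>*\<close>, a multiple of an orthogonal projection; hence \<open>\<phi>\<close> is positive.
  The form vanishes for \<open>X = v v\<^sup>*\<close> and for \<open>X = y y\<^sup>*\<close>.

  If \<open>\<phi> = \<phi>\<^sub>1 + \<phi>\<^sub>2\<close> with \<open>\<phi>\<^sub>1\<close> 2-positive and \<open>\<phi>\<^sub>2\<close> 2-copositive, both summands inherit these zeros.
  The block matrix with entries \<open>\<phi>\<^sub>1 (x x\<^sup>*)\<close>, \<open>\<phi>\<^sub>1 (x y\<^sup>*)\<close>, \<open>\<phi>\<^sub>1 (y x\<^sup>*)\<close>, \<open>\<phi>\<^sub>1 (y y\<^sup>*)\<close> is positive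
  semidefinite, so the zero at \<open>X = x x\<^sup>*\<close> in direction \<open>x\<close> forces \<open>\<phi>\<^sub>1 (y x\<^sup>*) x = 0\<close> for all \<open>x\<close> and
  \<open>y\<close>, and polarization in \<open>x\<close> gives \<open>\<phi>\<^sub>1 (y x\<^sup>*) = 0\<close>.  In the same way the zeros in direction \<open>U x\<close>
  kill \<open>\<phi>\<^sub>2 \<circ> \<tau>\<close>.  But \<open>\<phi> (x x\<^sup>*)\<close> has trace \<open>(d - 2) |x|\<^sup>2\<close>.
\<close>

section \<open>Hermitian inner product, conjugation and rank-one matrices\<close>

definition hip :: "complex ^ 'n::finite \<Rightarrow> complex ^ 'n \<Rightarrow> complex" where
  "hip v w = (\<Sum>i\<in>UNIV. cnj (v $ i) * w $ i)"

definition vcnj :: "complex ^ 'n::finite \<Rightarrow> complex ^ 'n" where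
  "vcnj v = (\<chi> i. cnj (v $ i))"

definition outer :: "complex ^ 'n::finite \<Rightarrow> complex ^ 'n \<Rightarrow> 'n cmat" where
  "outer y x = (\<chi> i j. y $ i * cnj (x $ j))"

lemma ketbra_eq_outer: "ketbra x = outer x x"
  by (simp add: ketbra_def outer_def)

lemma psd_iff: "A \<in> psd \<longleftrightarrow> conj_transpose A = A \<and> (\<forall>v. 0 \<le> Re (hip v (A *v v)))"
  by (simp add: psd_def hip_def)

lemma hip_add_right: "hip u (v + w) = hip u v + hip u w"
  and hip_diff_left: "hip (u - v) w = hip u w - hip v w"
  and hip_diff_right: "hip u (v - w) = hip u v - hip u w"
  and hip_scale_left: "hip (c *s u) w = cnj c * hip u w"
  and hip_scale_right: "hip u (c *s w) = c * hip u w"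
  by (simp_all add: hip_def algebra_simps sum.distrib sum_subtractf sum_distrib_left)

lemma hip_axis: "hip (axis i 1) w = w $ i"
proof -
  have "hip (axis i 1) w = (\<Sum>j\<in>UNIV. if j = i then w $ j else 0)"
    unfolding hip_def by (intro sum.cong) (auto simp: axis_def)
  then show ?thesis by simp
qed

lemma matrix_vec_axis: "(A *v axis i (1 :: complex)) $ k = A $ k $ i"
  by (simp add: matrix_vector_mult_def axis_def mult_delta_right)

lemma hip_commute: "hip w v = cnj (hip v w)"
  by (simp add: hip_def mult.commute)

lemma hip_zero_left: "hip 0 v = 0" and hip_zero_right: "hip v 0 = 0"
  by (simp_all add: hip_def)

lemma hip_self: "hip v v = of_real (\<Sum>i\<in>UNIV. (cmod (v $ i))\<^sup>2)"
  unfolding hip_def of_real_sum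
  by (intro sum.cong refl) (metis complex_norm_square mult.commute of_real_power)

lemma hip_self_eq_0_iff: "hip v v = 0 \<longleftrightarrow> v = 0"
  by (simp only: hip_self of_real_eq_0_iff) (simp add: sum_nonneg_eq_0_iff vec_eq_iff)

lemma hip_vcnj: "hip (vcnj v) (vcnj w) = hip w v"
  by (simp add: hip_def vcnj_def mult.commute)

lemma vcnj_vcnj: "vcnj (vcnj v) = v"
  by (simp add: vcnj_def)

lemma hip_adjoint: "hip v (A *v w) = hip (conj_transpose A *v v) w"
proof -
  have "hip v (A *v w) = (\<Sum>i\<in>UNIV. \<Sum>j\<in>UNIV. cnj (v $ i) * (A $ i $ j * w $ j))"
    by (simp add: hip_def matrix_vector_mult_def sum_distrib_left)
  also have "\<dots> = (\<Sum>j\<in>UNIV. \<Sum>i\<in>UNIV. cnj (v $ i) * (A $ i $ j * w $ j))"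
    by (rule sum.swap)
  also have "\<dots> = hip (conj_transpose A *v v) w"
    by (simp add: hip_def matrix_vector_mult_def conj_transpose_def sum_distrib_left mult_ac)
  finally show ?thesis .
qed

lemma outer_vec: "outer y x *v z = hip x z *s y"
  by (simp add: outer_def hip_def matrix_vector_mult_def vec_eq_iff sum_distrib_left mult_ac)

lemma trace_outer: "trace (outer y x) = hip x y"
  by (simp add: trace_def outer_def hip_def mult.commute)

lemma cscale_vec: "cscale c A *v v = c *s (A *v v)"
  by (simp add: cscale_def matrix_vector_mult_def vec_eq_iff sum_distrib_left mult_ac)

lemma matrix_vec_scale: "A *v (c *s v) = c *s (A *v (v :: complex ^ 'n::finite))"
  by (simp add: matrix_vector_mult_def vec_eq_iff sum_distrib_left mult_ac)

lemma conj_transpose_mult: "conj_transpose (A ** B) = conj_transpose B ** conj_transpose A"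
  by (simp add: conj_transpose_def matrix_matrix_mult_def mult.commute)

lemma conj_transpose_conj_transpose: "conj_transpose (conj_transpose A) = A"
  by (simp add: conj_transpose_def vec_eq_iff)

lemma trace_transpose: "trace (transpose A) = trace A"
  by (simp add: trace_def transpose_def)

lemma trace_cscale: "trace (cscale c A) = c * trace A"
  by (simp add: trace_def cscale_def sum_distrib_left)

section \<open>Positive semidefinite matrices\<close>

lemma outer_self_psd: "outer x x \<in> psd"
proof -
  have "hip v (outer x x *v v) = of_real ((cmod (hip x v))\<^sup>2)" for v
    by (simp add: outer_vec hip_scale_right hip_commute[of v x] complex_norm_square[symmetric])
  then show ?thesis
    by (simp add: psd_iff) (simp add: conj_transpose_def outer_def vec_eq_iff mult.commute)
qed

text \<open>Moving from \<open>v\<close> to \<open>v - t A v\<close> changes the form from 0 to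
  \<open>-2 t |A v|^2 + t^2 q\<close>, which is negative for small \<open>t > 0\<close> unless
  \<open>A v = 0\<close>.\<close>

lemma psd_form_eq_0_imp_kernel:
  assumes A: "A \<in> psd" and 0: "Re (hip v (A *v v)) = 0"
  shows "A *v v = 0"
proof -
  define w where "w = A *v v"
  have herm: "hip a (A *v b) = hip (A *v a) b" for a b
    using A by (simp add: hip_adjoint psd_iff)
  define n where "n = Re (hip w w)"
  define q where "q = Re (hip w (A *v w))"
  have n: "hip w w = of_real n"
    by (simp add: n_def hip_self)
  have "n \<ge> 0" by (simp add: n_def hip_self sum_nonneg)
  have pos: "0 \<le> - 2 * t * n + t\<^sup>2 * q" for t :: real
  proof -
    have "hip (v - of_real t *s w) (A *v (v - of_real t *s w))
        = hip v (A *v v) - 2 * of_real t * of_real n + of_real (t\<^sup>2) * hip w (A *v w)"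
      unfolding matrix_vector_mult_diff_distrib matrix_vec_scale hip_diff_left hip_diff_right
        hip_scale_left hip_scale_right
      by (simp add: herm[of v w] w_def[symmetric] n power2_eq_square algebra_simps)
    moreover have "0 \<le> Re (hip (v - of_real t *s w) (A *v (v - of_real t *s w)))"
      using A by (simp add: psd_iff)
    ultimately show ?thesis
      using 0 by (simp add: q_def)
  qed
  have "n = 0"
  proof (rule ccontr)
    assume "n \<noteq> 0"
    with \<open>n \<ge> 0\<close> have "n > 0" by simp
    have "q \<ge> 0" using A by (simp add: q_def psd_iff)
    \<comment> \<open>The \<open>+ 1\<close> covers \<open>q = 0\<close> and still gives
      \<open>t q <= n\<close>, so the quadratic term cannot outweigh \<open>2 t n\<close>.\<close>
    define t where "t = n / (q + 1)"
    have "t > 0" using \<open>n > 0\<close> \<open>q \<ge> 0\<close> by (simp add: t_def)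
    have "t * q \<le> n" using \<open>n > 0\<close> \<open>q \<ge> 0\<close> by (simp add: t_def field_simps)
    then have "t\<^sup>2 * q \<le> t * n"
      using \<open>t > 0\<close> by (simp add: power2_eq_square mult.assoc)
    moreover have "0 < t * n" using \<open>t > 0\<close> \<open>n > 0\<close> by simp
    ultimately show False using pos[of t] by linarith
  qed
  then show ?thesis using n by (simp add: hip_self_eq_0_iff w_def)
qed

text \<open>With \<open>s = |v|^2\<close>, the Hermitian matrix \<open>P = s I - v v* - y y*\<close>
  satisfies \<open>P P = s P\<close>. Hence \<open>s Tr (X P) = Tr (P X P) >= 0\<close>, and
  \<open>s\<close> can be cancelled once \<open>v\<close> is nonzero.\<close>

lemma psd_trace_bound:
  assumes X: "X \<in> psd" and orth: "hip v y = 0" and len: "hip y y = hip v v"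
  shows "0 \<le> Re (trace X * hip v v - hip v (X *v v) - hip y (X *v y))"
proof (cases "v = 0")
  case True
  then have "y = 0" using len hip_self_eq_0_iff by metis
  with True show ?thesis by (simp add: hip_zero_left)
next
  case False
  define s where "s = (\<Sum>i\<in>UNIV. (cmod (v $ i))\<^sup>2)"
  have s: "hip v v = of_real s" "hip y y = of_real s"
    unfolding len by (simp_all add: s_def hip_self)
  have "s \<noteq> 0" using False s hip_self_eq_0_iff by force
  moreover have "s \<ge> 0" by (simp add: s_def sum_nonneg)
  ultimately have "s > 0" by simp
  have orth': "hip y v = 0" using orth hip_commute[of y v] by simp
  define P where "P = cscale (of_real s) (mat 1) - outer v v - outer y y"
  have Pv: "P *v z = of_real s *s z - hip v z *s v - hip y z *s y" for z
    by (simp add: P_def matrix_vector_mult_diff_rdistrib cscale_vec outer_vec)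
  have herm: "conj_transpose P = P"
    by (auto simp: P_def conj_transpose_def cscale_def mat_def outer_def vec_eq_iff)
  have PP: "P ** P = cscale (of_real s) P"
    unfolding matrix_eq
    by (simp add: matrix_vector_mul_assoc[symmetric] cscale_vec)
       (simp add: Pv hip_diff_right hip_scale_right orth orth' s vec_eq_iff algebra_simps)
  have XP: "trace (X ** P) = trace X * hip v v - hip v (X *v v) - hip y (X *v y)"
  proof -
    have "X ** P = cscale (of_real s) X - outer (X *v v) v - outer (X *v y) y"
      unfolding matrix_eq
      by (simp add: matrix_vector_mul_assoc[symmetric] Pv matrix_vector_mult_diff_rdistrib
          cscale_vec outer_vec matrix_vector_mult_diff_distrib matrix_vec_scale)
    then show ?thesis
      by (simp add: trace_sub trace_cscale trace_outer s mult.commute)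
  qed
  have "0 \<le> Re (trace (P ** X ** P))"
  proof -
    \<comment> \<open>Each diagonal entry of \<open>P X P\<close> is the form of \<open>X\<close> at
      a column of \<open>P\<close>.\<close>
    have "(P ** X ** P) $ i $ i = hip (P *v axis i 1) (X *v (P *v axis i 1))" for i
    proof -
      have "A $ i $ i = hip (axis i 1) (A *v axis i 1)" for A
        by (simp add: hip_axis matrix_vec_axis)
      from this[of "P ** X ** P"] show ?thesis
        by (simp add: matrix_vector_mul_assoc[symmetric] hip_adjoint[of _ P] herm)
    qed
    then show ?thesis
      using X by (simp add: trace_def psd_iff sum_nonneg)
  qed
  also have "trace (P ** X ** P) = trace (X ** (P ** P))"
    by (metis matrix_mul_assoc trace_mul_sym)
  also have "X ** (P ** P) = cscale (of_real s) (X ** P)"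
    unfolding PP matrix_eq
    by (simp add: matrix_vector_mul_assoc[symmetric] cscale_vec matrix_vec_scale)
  finally have "0 \<le> s * Re (trace (X ** P))"
    by (simp add: trace_cscale)
  then show ?thesis
    using \<open>s > 0\<close> by (simp add: XP zero_le_mult_iff)
qed

section \<open>Positivity, zeros and trace of the Breuer-Hall map\<close>

lemma clinear_breuer_hall: "clinear_map (breuer_hall U)"
  unfolding clinear_map_iff breuer_hall_def
  by (auto simp: vec_eq_iff cscale_def trace_def mat_def transpose_def matrix_matrix_mult_def
      sum.distrib sum_distrib_left sum_distrib_right algebra_simps)

context
  fixes U :: "complex ^ 'n::finite ^ 'n"
  assumes unitary: "unitary_mat U" and antisym: "transpose U = - U"
begin

text \<open>The inner product is the conjugate of a bilinear expression \<open>S\<close> in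
  \<open>v\<close> and \<open>v\<close>; exchanging the two summation indices gives
  \<open>S = -S\<close> by antisymmetry.\<close>

lemma antisym_orthogonal: "hip v (vcnj (conj_transpose U *v v)) = 0"
proof -
  define S where "S = (\<Sum>i\<in>UNIV. \<Sum>j\<in>UNIV. v $ i * cnj (U $ j $ i) * v $ j)"
  have U: "U $ j $ i = - (U $ i $ j)" for i j
  proof -
    have "U $ j $ i = transpose U $ i $ j" by (simp add: transpose_def)
    also have "\<dots> = - (U $ i $ j)" by (subst antisym) simp
    finally show ?thesis .
  qed
  have "S = (\<Sum>j\<in>UNIV. \<Sum>i\<in>UNIV. v $ i * cnj (U $ j $ i) * v $ j)"
    unfolding S_def by (rule sum.swap)
  also have "\<dots> = (\<Sum>j\<in>UNIV. \<Sum>i\<in>UNIV. - (v $ j * cnj (U $ i $ j) * v $ i))"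
    by (intro sum.cong refl) (subst U, simp)
  also have "\<dots> = - S"
    by (simp add: S_def sum_negf)
  finally have "S = 0" by simp
  moreover have "hip v (vcnj (conj_transpose U *v v)) = cnj S"
    by (simp add: S_def hip_def vcnj_def matrix_vector_mult_def conj_transpose_def
        sum_distrib_left mult_ac)
  ultimately show ?thesis by simp
qed

lemma hip_unitary: "hip (vcnj (conj_transpose U *v v)) (vcnj (conj_transpose U *v v)) = hip v v"
  using unitary
  by (simp add: hip_vcnj hip_adjoint[of _ "conj_transpose U"] conj_transpose_conj_transpose
      matrix_vector_mul_assoc unitary_mat_def)

text \<open>In the last term \<open>U\<close> moves onto \<open>v\<close> as its adjoint, and the
  transposition of \<open>X\<close> is traded for conjugating the vector.\<close>

lemma breuer_hall_form:
  "hip v (breuer_hall U X *v v) = trace X * hip v v - hip v (X *v v)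
     - hip (vcnj (conj_transpose U *v v)) (X *v vcnj (conj_transpose U *v v))"
proof -
  have tr: "hip w (transpose X *v w) = hip (vcnj w) (X *v vcnj w)" for w
  proof -
    have "hip w (transpose X *v w) = (\<Sum>i\<in>UNIV. \<Sum>j\<in>UNIV. cnj (w $ i) * (X $ j $ i * w $ j))"
      by (simp add: hip_def matrix_vector_mult_def transpose_def sum_distrib_left)
    also have "\<dots> = (\<Sum>j\<in>UNIV. \<Sum>i\<in>UNIV. cnj (w $ i) * (X $ j $ i * w $ j))"
      by (rule sum.swap)
    also have "\<dots> = hip (vcnj w) (X *v vcnj w)"
      by (simp add: hip_def vcnj_def matrix_vector_mult_def sum_distrib_left mult_ac)
    finally show ?thesis .
  qed
  show ?thesis
    by (simp add: breuer_hall_def matrix_vector_mult_diff_rdistrib hip_diff_right cscale_vec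
        hip_scale_right matrix_vector_mul_assoc[symmetric] hip_adjoint[of v U] tr del: transpose_matrix_vector)
qed

text \<open>The first zero serves the 2-positive summand, the second the 2-copositive one.\<close>

lemma breuer_hall_form_zero:
  "hip v (breuer_hall U (outer v v) *v v) = 0"
  "hip v (breuer_hall U (outer (vcnj (conj_transpose U *v v)) (vcnj (conj_transpose U *v v))) *v v) = 0"
  using antisym_orthogonal[of v] hip_commute[of "vcnj (conj_transpose U *v v)" v]
  by (simp_all add: breuer_hall_form trace_outer outer_vec hip_scale_right hip_unitary hip_zero_right)

lemma positive_map_breuer_hall: "positive_map (breuer_hall U)"
  unfolding positive_map_def
proof (intro conjI clinear_breuer_hall image_subsetI)
  fix X :: "'n cmat" assume X: "X \<in> psd"
  then have H: "conj_transpose X = X" by (simp add: psd_iff)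
  have "cnj (trace X) = trace X"
  proof -
    have "cnj (trace X) = trace (conj_transpose X)" by (simp add: trace_def conj_transpose_def)
    then show ?thesis by (simp add: H)
  qed
  then have "conj_transpose (cscale (trace X) (mat 1)) = cscale (trace X) (mat 1 :: 'n cmat)"
    by (simp add: conj_transpose_def cscale_def mat_def vec_eq_iff)
  moreover have "conj_transpose (transpose X) = transpose X"
    using H by (simp add: conj_transpose_def transpose_def vec_eq_iff)
  moreover have "conj_transpose (A - B) = conj_transpose A - conj_transpose B" for A B :: "'n cmat"
    by (simp add: conj_transpose_def vec_eq_iff)
  ultimately have "conj_transpose (breuer_hall U X) = breuer_hall U X"
    by (simp add: breuer_hall_def conj_transpose_mult conj_transpose_conj_transpose H
        matrix_mul_assoc)
  moreover have "0 \<le> Re (hip v (breuer_hall U X *v v))" for v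
    unfolding breuer_hall_form by (rule psd_trace_bound[OF X antisym_orthogonal hip_unitary])
  ultimately show "breuer_hall U X \<in> psd"
    by (simp add: psd_iff)
qed

text \<open>Supplies the final contradiction: for nonzero \<open>x\<close> this trace vanishes only
  in dimension 2.\<close>

lemma trace_breuer_hall_outer:
  "trace (breuer_hall U (outer x x)) = (of_nat CARD('n) - 2) * hip x x"
proof -
  have "trace (U ** transpose (outer x x) ** conj_transpose U)
      = trace (conj_transpose U ** U ** transpose (outer x x))"
    by (metis matrix_mul_assoc trace_mul_sym)
  also have "\<dots> = hip x x"
    using unitary by (simp add: unitary_mat_def trace_transpose trace_outer)
  finally show ?thesis
    by (simp add: breuer_hall_def trace_sub trace_cscale trace_outer trace_I left_diff_distrib)
qed

end

section \<open>Consequences of 2-positivity for rank-one matrices\<close>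

lemma tensor_vec_component: "tensor_vec a b $ (i, k) = a $ i * b $ k"
  by (simp add: tensor_vec_def)

lemma ketbra_in_V_lower_2:
  fixes a b c d :: "complex ^ 'n::finite"
  shows "ketbra (tensor_vec a b + tensor_vec c d) \<in> V_lower 2"
proof -
  let ?\<psi> = "tensor_vec a b + tensor_vec c d"
  have "?\<psi> = (\<Sum>i<2. tensor_vec (if i = (0::nat) then a else c) (if i = 0 then b else d))"
    by (simp add: numeral_2_eq_2)
  then have "schmidt_rank ?\<psi> \<le> 2"
    by (subst schmidt_rank_le_iff)
      (rule exI[of _ "\<lambda>i. if i = 0 then a else c"], rule exI[of _ "\<lambda>i. if i = 0 then b else d"])
  then have "\<exists>(m::nat) \<psi>. ketbra ?\<psi> = (\<Sum>i<m. ketbra (\<psi> i)) \<and> (\<forall>i<m. schmidt_rank (\<psi> i) \<le> 2)"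
    by (intro exI[of _ 1] exI[of _ "\<lambda>_. ?\<psi>"]) simp
  then have "schmidt_number (ketbra ?\<psi>) \<le> 2"
    unfolding schmidt_number_def by (rule Least_le)
  then show ?thesis
    by (simp add: V_lower_def ketbra_eq_outer outer_self_psd)
qed

text \<open>Partial transposition followed by \<open>id_tensor \<phi>\<close> is
  \<open>id_tensor\<close> of the composite map. Copositive summands thereby fall under the lemmas
  on 2-positive maps.\<close>

lemma P_upper_imp_P_lower:
  assumes "\<phi> \<in> P_upper k"
  shows "(\<lambda>X. \<phi> (transpose X)) \<in> P_lower k"
proof -
  have "id_tensor (\<lambda>X. \<phi> (transpose X)) \<rho> = id_tensor \<phi> (id_tensor transpose \<rho>)"
    for \<rho> :: "('a \<times> 'a) cmat"
  proof -
    have "block (id_tensor transpose \<rho>) i j = transpose (block \<rho> i j)" for i j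
      by (simp add: block_def id_tensor_def vec_eq_iff)
    then show ?thesis by (simp add: id_tensor_def)
  qed
  moreover have "transpose (A + B) = transpose A + transpose B"
    "transpose (cscale c A) = cscale c (transpose A)" for A B :: "'a cmat" and c
    by (simp_all add: transpose_def cscale_def vec_eq_iff)
  ultimately show ?thesis
    using assms by (auto simp: P_upper_def P_lower_def V_upper_def clinear_map_iff)
qed

context
  fixes \<phi> :: "'n::finite cmat \<Rightarrow> 'n cmat"
  assumes two_positive: "\<phi> \<in> P_lower 2" and dim: "2 \<le> CARD('n)"
begin

text \<open>\<open>M\<close> is the image of the ketbra of \<open>e (x) x + f (x) y\<close>, a
  vector of Schmidt rank at most 2. Testing with \<open>v = e (x) z\<close> selects the block column
  of \<open>e\<close>, and \<open>i\<close> is the index \<open>f\<close>.\<close>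

lemma two_positive_block:
  fixes x y z :: "complex ^ 'n"
  obtains M :: "('n \<times> 'n) cmat" and v :: "complex ^ ('n \<times> 'n)" and i :: 'n where
    "M \<in> psd" "hip v (M *v v) = hip z (\<phi> (outer x x) *v z)"
    "\<And>k. (M *v v) $ (i, k) = (\<phi> (outer y x) *v z) $ k"
proof -
  \<comment> \<open>The two product terms need distinct basis vectors of the first factor, whence
    the bound on the dimension.\<close>
  obtain e f :: 'n where ef: "e \<noteq> f"
    using dim by (metis card_2_iff' ex_card)
  define \<psi> where "\<psi> = tensor_vec (axis e 1) x + tensor_vec (axis f 1) y"
  define M where "M = id_tensor \<phi> (ketbra \<psi>)"
  define v where "v = tensor_vec (axis e 1) z"
  have psi: "\<psi> $ (e, k) = x $ k" "\<psi> $ (f, k) = y $ k" for k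
    using ef by (simp_all add: \<psi>_def tensor_vec_component axis_def)
  have blocks: "block (ketbra \<psi>) e e = outer x x" "block (ketbra \<psi>) f e = outer y x"
    by (simp_all add: block_def ketbra_def outer_def psi)
  have Mv: "(M *v v) $ (i, k) = (\<phi> (block (ketbra \<psi>) i e) *v z) $ k" for i k
  proof -
    have "(M *v v) $ (i, k) = (\<Sum>p\<in>UNIV \<times> UNIV. M $ (i, k) $ p * v $ p)"
      by (simp add: matrix_vector_mult_def)
    also have "\<dots> = (\<Sum>j\<in>UNIV. \<Sum>l\<in>UNIV. M $ (i, k) $ (j, l) * v $ (j, l))"
      by (simp add: sum.cartesian_product)
    also have "\<dots> = (\<Sum>j\<in>UNIV. if j = e then \<Sum>l\<in>UNIV. M $ (i, k) $ (j, l) * z $ l else 0)"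
      by (intro sum.cong refl) (simp add: v_def tensor_vec_component axis_def)
    finally show ?thesis
      by (simp add: M_def id_tensor_def matrix_vector_mult_def)
  qed
  have "hip v w = (\<Sum>j\<in>UNIV. \<Sum>l\<in>UNIV. cnj (v $ (j, l)) * w $ (j, l))" for w
    by (simp add: hip_def sum.cartesian_product)
  also have "\<dots> w = (\<Sum>j\<in>UNIV. if j = e then \<Sum>l\<in>UNIV. cnj (z $ l) * w $ (j, l) else 0)" for w
    by (intro sum.cong refl) (simp add: v_def tensor_vec_component axis_def)
  finally have "hip v (M *v v) = hip z (\<phi> (outer x x) *v z)"
    by (simp add: Mv blocks hip_def)
  moreover have "M \<in> psd"
    using two_positive ketbra_in_V_lower_2 unfolding M_def \<psi>_def P_lower_def by blast
  ultimately show ?thesis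
    using Mv blocks(2) that by metis
qed

lemma two_positive_form_nonneg: "0 \<le> Re (hip z (\<phi> (outer x x) *v z))"
  by (rule two_positive_block[of z x x]) (metis psd_iff)

text \<open>A zero of the form in the \<open>(x, x)\<close> block is a zero of the whole form of
  \<open>M\<close>, hence a kernel vector of \<open>M\<close>; the other block row is the
  claim.\<close>

lemma two_positive_kernel:
  assumes "Re (hip z (\<phi> (outer x x) *v z)) = 0"
  shows "\<phi> (outer y x) *v z = 0"
proof (rule two_positive_block[of z x y])
  fix M v i
  assume M: "M \<in> psd" "hip v (M *v v) = hip z (\<phi> (outer x x) *v z)"
    and Mv: "\<And>k. (M *v v) $ (i, k) = (\<phi> (outer y x) *v z) $ k"
  have "M *v v = 0"
    using M assms by (intro psd_form_eq_0_imp_kernel) simp_all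
  then show ?thesis
    using Mv by (simp add: vec_eq_iff)
qed

text \<open>\<open>B\<close> is sesquilinear with zero diagonal, so it vanishes by complex
  polarization. The matrix \<open>W\<close> lets one statement serve both summands: it is the
  identity for one and \<open>U\<close> for the other.\<close>

lemma two_positive_vanish:
  assumes zero: "\<And>x. Re (hip (W *v x) (\<phi> (outer x x) *v (W *v x))) = 0"
  shows "\<phi> (outer y x) *v (W *v z) = 0"
proof -
  have lin: "\<phi> (A + B) = \<phi> A + \<phi> B" "\<phi> (cscale c A) = cscale c (\<phi> A)" for A B c
    using two_positive by (simp_all add: P_lower_def clinear_map_iff)
  define B where "B x z = \<phi> (outer y x) *v (W *v z)" for x z
  have diag: "B x x = 0" for x
    unfolding B_def by (rule two_positive_kernel[OF zero])
  have "outer y (a + b) = outer y a + outer y b" "outer y (c *s a) = cscale (cnj c) (outer y a)"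
    for a b c by (simp_all add: outer_def cscale_def vec_eq_iff algebra_simps)
  then have B: "B (a + b) w = B a w + B b w" "B (c *s a) w = cnj c *s B a w"
    "B w (a + b) = B w a + B w b" "B w (c *s a) = c *s B w a" for a b c w
    by (simp_all add: B_def lin matrix_vector_mult_add_rdistrib matrix_vector_right_distrib
        cscale_vec matrix_vec_scale)
  have "B x z + B z x = 0"
  proof -
    have "B (x + z) (x + z) = B x x + B z z + (B x z + B z x)"
      by (simp only: B add_ac)
    then show ?thesis by (simp only: diag) simp
  qed
  \<comment> \<open>\<open>B\<close> is conjugate-linear in its first argument and linear in its
    second, so the factor \<open>\<i>\<close> reverses one sign and separates the two cross
    terms.\<close>
  moreover have "\<i> *s B x z - \<i> *s B z x = 0"
  proof -
    have "B (x + \<i> *s z) (x + \<i> *s z) = B x x + B z z + (\<i> *s B x z - \<i> *s B z x)"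
      by (simp only: B) (simp add: vec_eq_iff)
    then show ?thesis by (simp only: diag) simp
  qed
  ultimately have "B x z = 0"
    by (simp add: vec_eq_iff)
  then show ?thesis by (simp add: B_def)
qed

end

section \<open>Vanishing of both summands and the trace contradiction\<close>

theorem theorem3:
  fixes U :: "complex ^ 'n::finite ^ 'n"
  assumes "4 \<le> CARD('n)" and "even CARD('n)"
    and "unitary_mat U" and "transpose U = - U"
  shows "atomic (breuer_hall U)"
  unfolding atomic_def
proof (intro conjI notI positive_map_breuer_hall[OF assms(3,4)])
  assume "\<exists>\<phi>\<^sub>1\<in>P_lower 2. \<exists>\<phi>\<^sub>2\<in>P_upper 2. breuer_hall U = (\<lambda>X. \<phi>\<^sub>1 X + \<phi>\<^sub>2 X)"
  then obtain \<phi>1 \<phi>2 where \<phi>1: "\<phi>1 \<in> P_lower 2" and \<phi>2: "\<phi>2 \<in> P_upper 2"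
    and eq: "breuer_hall U X = \<phi>1 X + \<phi>2 X" for X
    by metis
  define \<psi> where "\<psi> X = \<phi>2 (transpose X)" for X
  have \<psi>: "\<psi> \<in> P_lower 2"
    using P_upper_imp_P_lower[OF \<phi>2] by (simp add: \<psi>_def[abs_def])
  have dim: "2 \<le> CARD('n)" using assms(1) by simp
  have \<phi>2_outer: "\<phi>2 (outer x x) = \<psi> (outer (vcnj x) (vcnj x))" for x
    by (simp add: \<psi>_def transpose_def outer_def vcnj_def mult.commute)
  have split: "Re (hip z (\<phi>1 (outer x x) *v z)) + Re (hip z (\<phi>2 (outer x x) *v z))
      = Re (hip z (breuer_hall U (outer x x) *v z))" for x z
    by (simp add: eq matrix_vector_mult_add_rdistrib hip_add_right)
  have nonneg1: "0 \<le> Re (hip z (\<phi>1 (outer x x) *v z))" for x z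
    by (rule two_positive_form_nonneg[OF \<phi>1 dim])
  have nonneg2: "0 \<le> Re (hip z (\<phi>2 (outer x x) *v z))" for x z
    unfolding \<phi>2_outer by (rule two_positive_form_nonneg[OF \<psi> dim])
  \<comment> \<open>Two nonnegative terms with sum zero are both zero.\<close>
  have "Re (hip x (\<phi>1 (outer x x) *v x)) = 0" for x
    using split[of x x] nonneg1[of x x] nonneg2[of x x]
    by (simp add: breuer_hall_form_zero[OF assms(3,4)])
  then have "\<phi>1 (outer x x) *v (mat 1 *v z) = 0" for x z
    by (intro two_positive_vanish[OF \<phi>1 dim]) simp
  then have v1: "\<phi>1 (outer x x) *v z = 0" for x z by simp
  have UU: "conj_transpose U *v (U *v z) = z" "U *v (conj_transpose U *v z) = z" for z
    using assms(3) by (simp_all add: matrix_vector_mul_assoc unitary_mat_def)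
  \<comment> \<open>At \<open>v = U x\<close> the vector \<open>conj (U* v)\<close> is
    \<open>conj x\<close>, and transposition turns its rank-one matrix back into that of
    \<open>x\<close>; hence the argument of \<open>\<psi>\<close>.\<close>
  have "Re (hip (U *v x) (\<psi> (outer x x) *v (U *v x))) = 0" for x
    using split[of "U *v x" "vcnj x"] nonneg1[of "U *v x" "vcnj x"] nonneg2[of "U *v x" "vcnj x"]
      breuer_hall_form_zero(2)[OF assms(3,4), of "U *v x"]
    by (simp add: UU \<phi>2_outer vcnj_vcnj)
  \<comment> \<open>Every \<open>z\<close> has the form \<open>U w\<close> with
    \<open>w = U* z\<close>, so vanishing on the range of \<open>U\<close> is vanishing
    everywhere.\<close>
  then have "\<psi> (outer x x) *v (U *v (conj_transpose U *v z)) = 0" for x z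
    by (intro two_positive_vanish[OF \<psi> dim])
  then have v2: "\<phi>2 (outer x x) *v z = 0" for x z
    by (simp add: UU \<phi>2_outer)
  \<comment> \<open>\<open>undefined\<close> stands for an arbitrary index; any unit vector would
    serve.\<close>
  define x :: "complex ^ 'n" where "x = axis undefined 1"
  have "breuer_hall U (outer x x) = 0"
    unfolding matrix_eq by (simp add: eq matrix_vector_mult_add_rdistrib v1 v2)
  then have "(of_nat CARD('n) - 2) * hip x x = 0"
    using trace_breuer_hall_outer[OF assms(3,4), of x] by (simp add: trace_def)
  moreover have "hip x x = 1"
    by (simp add: x_def hip_axis)
  ultimately have "of_nat CARD('n) = (of_nat 2 :: complex)" by simp
  then have "CARD('n) = 2" unfolding of_nat_eq_iff .
  then show False using assms(1) by simp
qed

end
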